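(* Let $X$ and $Y$ be (real) Fréchet spaces and let $\Phi:X\times Y\to\overline{\mathbb R}$ be a proper, convex and lower semicontinuous function with $v(P_\Phi)\in\mathbb R$. Consider the conditions: (RC1) there exists $x'\in X$ such that $(x',0)\in\operatorname{dom}\Phi$ and $\Phi(x',\cdot)$ is continuous at $0$; (RC2) $0\in\operatorname{int}(\operatorname{pr}_Y(\operatorname{dom}\Phi))$; (RC3) $0\in\operatorname{core}(\operatorname{pr}_Y(\operatorname{dom}\Phi))$; (RC6) $0\in\operatorname{qi}(\operatorname{pr}_Y(\operatorname{dom}\Phi))$ and $(0,0)\notin\operatorname{qri}[\operatorname{co}(E\cup\{(0,0)\})]$; (RC7) $0\in\operatorname{qi}[\operatorname{pr}_Y(\operatorname{dom}\Phi)-\operatorname{pr}_Y(\operatorname{dom}\Phi)]$, $0\in\operatorname{qri}(\operatorname{pr}_Y(\operatorname{dom}\Phi))$ and $(0,0)\notin\operatorname{qri}[\operatorname{co}(E\cup\{(0,0)\})]$. Then (RC1) $\Rightarrow$ (RC2) $\Leftrightarrow$ (RC3) $\Rightarrow$ (RC6) $\Leftrightarrow$ (RC7).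
   Context: $\overline{\mathbb R}=\mathbb R\cup\{\pm\infty\}$. $\operatorname{dom}\Phi=\{(x,y):\Phi(x,y)<+\infty\}$, $\operatorname{epi}\Phi=\{(x,y,r)\in X\times Y\times\mathbb R:\Phi(x,y)\le r\}$; $\Phi$ is proper if $\operatorname{dom}\Phi\ne\emptyset$ and $\Phi>-\infty$ everywhere. $\operatorname{pr}_Y$, $\operatorname{pr}_{Y\times\mathbb R}$ are the projections. $v(P_\Phi)=\inf_{x\in X}\Phi(x,0)$. $E:=\operatorname{pr}_{Y\times\mathbb R}(\operatorname{epi}(\Phi-v(P_\Phi)))=\{(y,r)\in Y\times\mathbb R:\exists x\in X,\ \Phi(x,y)-v(P_\Phi)\le r\}$. For a nonempty convex subset $U$ of a separated locally convex space $V$, $\operatorname{cone}(U)=\bigcup_{t\ge0}tU$; $\operatorname{core}(U)=\{u\in U:\operatorname{cone}(U-u)=V\}$; $\operatorname{qi}(U)=\{u\in U:\operatorname{cl}(\operatorname{cone}(U-u))=V\}$; $\operatorname{qri}(U)=\{u\in U:\operatorname{cl}(\operatorname{cone}(U-u))\text{ is a linear subspace of }V\}$. $\operatorname{int}$ is the interior, $\operatorname{co}$ the convex hull, $\operatorname{cl}$ the closure. *)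

theory Defs
  imports "HOL-Analysis.Analysis"
begin

(* Addition and negation are continuous by topological_ab_group_add; the Hausdorff axiom
   follows from metrizability but is needed for the sort.
   The last conjunct of locally_convex is convexity of C, unfolded because the constant
   convex cannot be used inside the class specification. *)
class frechet_space = real_vector + topological_ab_group_add + t2_space +
  assumes tendsto_scaleR_nhds:
    "filterlim (\<lambda>p. fst p *\<^sub>R snd p) (nhds (c *\<^sub>R x)) (nhds (c::real) \<times>\<^sub>F nhds x)"
  assumes locally_convex:
    "open U \<Longrightarrow> 0 \<in> U \<Longrightarrow> \<exists>C. open C \<and> 0 \<in> C \<and> C \<subseteq> U \<and>
      (\<forall>x\<in>C. \<forall>y\<in>C. \<forall>u\<ge>0. \<forall>v\<ge>0. u + v = 1 \<longrightarrow> u *\<^sub>R x + v *\<^sub>R y \<in> C)"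
  assumes complete_invariant_metric:
    "\<exists>d. Metric_space UNIV d \<and> (\<forall>x y z. d (x + z) (y + z) = d x y) \<and>
      (\<forall>U. openin (Metric_space.mtopology UNIV d) U \<longleftrightarrow> open U) \<and>
      Metric_space.mcomplete UNIV d"

instance banach \<subseteq> frechet_space
proof
  show "filterlim (\<lambda>p. fst p *\<^sub>R snd p) (nhds (c *\<^sub>R x)) (nhds c \<times>\<^sub>F nhds x)"
    for c :: real and x :: 'a
    by (intro tendsto_scaleR filterlim_fst filterlim_snd)
  show "\<exists>C. open C \<and> 0 \<in> C \<and> C \<subseteq> U \<and>
      (\<forall>x\<in>C. \<forall>y\<in>C. \<forall>u\<ge>0. \<forall>v\<ge>0. u + v = 1 \<longrightarrow> u *\<^sub>R x + v *\<^sub>R y \<in> C)"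
    if "open U" "0 \<in> U" for U :: "'a set"
    using that unfolding convex_def[symmetric] by (meson centre_in_ball convex_ball open_ball open_contains_ball)
  show "\<exists>d. Metric_space UNIV d \<and> (\<forall>x y z::'a. d (x + z) (y + z) = d x y) \<and>
      (\<forall>U. openin (Metric_space.mtopology UNIV d) U \<longleftrightarrow> open U) \<and>
      Metric_space.mcomplete UNIV d"
    by (rule exI[of _ dist])
       (simp add: Met_TC.Metric_space_axioms complete_UNIV)
qed

definition cone_of :: "'v::real_vector set \<Rightarrow> 'v set" where
  "cone_of U = (\<Union>t\<in>{0..}. (\<lambda>u. t *\<^sub>R u) ` U)"

definition core :: "'v::real_vector set \<Rightarrow> 'v set" where
  "core U = {u \<in> U. cone_of ((\<lambda>w. w - u) ` U) = UNIV}"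

definition qi :: "'v::{real_vector, topological_space} set \<Rightarrow> 'v set" where
  "qi U = {u \<in> U. closure (cone_of ((\<lambda>w. w - u) ` U)) = UNIV}"

definition qri :: "'v::{real_vector, topological_space} set \<Rightarrow> 'v set" where
  "qri U = {u \<in> U. subspace (closure (cone_of ((\<lambda>w. w - u) ` U)))}"

definition effective_domain :: "('v \<Rightarrow> ereal) \<Rightarrow> 'v set" where
  "effective_domain f = {z. f z < \<infinity>}"

definition proper_fun :: "('v \<Rightarrow> ereal) \<Rightarrow> bool" where
  "proper_fun f \<longleftrightarrow> effective_domain f \<noteq> {} \<and> (\<forall>z. f z > -\<infinity>)"

(* On ereal, \<infinity> + -\<infinity> = -\<infinity> + \<infinity> = \<infinity>, which is the convention of convex analysis;
   the endpoints t = 0, 1 are trivial and omitted. *)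
definition convex_fun :: "('v::real_vector \<Rightarrow> ereal) \<Rightarrow> bool" where
  "convex_fun f \<longleftrightarrow> (\<forall>z w. \<forall>t\<in>{0<..<1::real}.
     f (t *\<^sub>R z + (1 - t) *\<^sub>R w) \<le> ereal t * f z + ereal (1 - t) * f w)"

definition lsc_fun :: "('v::topological_space \<Rightarrow> ereal) \<Rightarrow> bool" where
  "lsc_fun f \<longleftrightarrow> (\<forall>z. f z \<le> Liminf (nhds z) f)"

definition primal_value :: "('x \<times> 'y::zero \<Rightarrow> ereal) \<Rightarrow> ereal" where
  "primal_value \<Phi> = (INF x. \<Phi> (x, 0))"

definition prY_dom :: "('x \<times> 'y \<Rightarrow> ereal) \<Rightarrow> 'y set" where
  "prY_dom \<Phi> = snd ` effective_domain \<Phi>"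

definition epi :: "('x \<times> 'y \<Rightarrow> ereal) \<Rightarrow> ('x \<times> 'y \<times> real) set" where
  "epi \<Phi> = {(x, y, r). \<Phi> (x, y) \<le> ereal r}"

definition E_set :: "('x \<times> 'y::zero \<Rightarrow> ereal) \<Rightarrow> ('y \<times> real) set" where
  "E_set \<Phi> = snd ` epi (\<lambda>z. \<Phi> z - primal_value \<Phi>)"

definition RC1 :: "('x \<times> 'y::{zero, t2_space} \<Rightarrow> ereal) \<Rightarrow> bool" where
  "RC1 \<Phi> \<longleftrightarrow> (\<exists>x'. (x', 0) \<in> effective_domain \<Phi> \<and> isCont (\<lambda>y. \<Phi> (x', y)) 0)"

definition RC2 :: "('x \<times> 'y::{zero, topological_space} \<Rightarrow> ereal) \<Rightarrow> bool" where
  "RC2 \<Phi> \<longleftrightarrow> 0 \<in> interior (prY_dom \<Phi>)"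

definition RC3 :: "('x \<times> 'y::real_vector \<Rightarrow> ereal) \<Rightarrow> bool" where
  "RC3 \<Phi> \<longleftrightarrow> 0 \<in> core (prY_dom \<Phi>)"

definition RC6 :: "('x \<times> 'y::{real_vector, topological_space} \<Rightarrow> ereal) \<Rightarrow> bool" where
  "RC6 \<Phi> \<longleftrightarrow> 0 \<in> qi (prY_dom \<Phi>) \<and>
     (0, 0) \<notin> qri (convex hull (E_set \<Phi> \<union> {(0, 0)}))"

definition RC7 :: "('x \<times> 'y::{real_vector, topological_space} \<Rightarrow> ereal) \<Rightarrow> bool" where
  "RC7 \<Phi> \<longleftrightarrow> 0 \<in> qi {a - b | a b. a \<in> prY_dom \<Phi> \<and> b \<in> prY_dom \<Phi>} \<and>
     0 \<in> qri (prY_dom \<Phi>) \<and>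
     (0, 0) \<notin> qri (convex hull (E_set \<Phi> \<union> {(0, 0)}))"

end

theory Submission
  imports Defs
begin

text \<open>
Write \<open>D\<close> for the projection of \<open>dom \<Phi>\<close> on \<open>Y\<close>.

The deep implication is (RC3) \<open>\<Longrightarrow>\<close> (RC2): a projection that absorbs every direction is a neighbourhood
of \<open>0\<close>. This is an open mapping theorem for closed convex relations (Robinson, Ursescu). Choose \<open>x0\<close>
and \<open>r\<close> with \<open>\<Phi>(x0, 0) \<le> r\<close>. By convexity the sublevel set \<open>G = {\<Phi> \<le> r + 1}\<close> still has an absorbing
projection, because \<open>\<Phi>\<close> exceeds \<open>r\<close> by at most \<open>1\<close> sufficiently close to \<open>(x0, 0)\<close> on each segment into
\<open>dom \<Phi>\<close>; and \<open>G\<close> is closed because \<open>\<Phi>\<close> is lower semicontinuous. The projection of \<open>G\<close> is a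
neighbourhood of \<open>0\<close> by two classical steps. The Baire theorem in \<open>Y\<close> shows that the closures of the
images of small neighbourhoods are neighbourhoods (\<open>closure_local_image_nhd\<close>). A successive
approximation removes the closures (\<open>closed_convex_image_nhd_origin\<close>): a point \<open>y\<close> near \<open>0\<close> is the
limit of the sums of \<open>2^-(k+1) b_k\<close> with \<open>(a_k, b_k) \<in> G\<close> and \<open>a_k\<close> so small that the corresponding
sums in the complete space \<open>X\<close> converge; convexity keeps the partial sums in \<open>G\<close>, and closedness
keeps the limit there.

This gives more than (RC2), namely a bound \<open>M\<close> of the value function
\<open>y \<mapsto> inf_x \<Phi>(x, y)\<close> on a neighbourhood of \<open>0\<close> (\<open>bounded_above_near_core\<close>). That bound is what (RC6)
requires. A convex function bounded above near \<open>0\<close> is also bounded below near \<open>0\<close>, with a linear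
modulus along rays, so no nonnegative multiple of a point of \<open>E\<close> comes close to \<open>(0, -1)\<close>. As \<open>(0, 1)\<close> does belong
to \<open>E\<close>, the closed cone generated by \<open>co (E \<union> {(0, 0)})\<close> is not a subspace
(\<open>origin_not_in_qri_hull_E_set\<close>).

The other implications are soft: continuity at \<open>0\<close> gives finiteness nearby, neighbourhoods of \<open>0\<close>
absorb, and the equivalence of (RC6) and (RC7) is an identity between quasi-interiors
(\<open>qi_zero_iff\<close>).
\<close>

section \<open>Cones and Frechet spaces\<close>

lemma cone_of_iff: "y \<in> cone_of U \<longleftrightarrow> (\<exists>t\<ge>0. \<exists>u\<in>U. y = t *\<^sub>R u)"
  unfolding cone_of_def by auto

lemma cone_of_mono: "A \<subseteq> B \<Longrightarrow> cone_of A \<subseteq> cone_of B"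
  unfolding cone_of_def by blast

lemma tendsto_scaleR_frechet:
  fixes g :: "'a \<Rightarrow> 'v::frechet_space"
  assumes "(f \<longlongrightarrow> c) F" "(g \<longlongrightarrow> x) F"
  shows "((\<lambda>s. f s *\<^sub>R g s) \<longlongrightarrow> c *\<^sub>R x) F"
  using filterlim_compose[OF tendsto_scaleR_nhds filterlim_Pair[OF assms]] by simp

lemma continuous_on_scaleR_frechet:
  fixes g :: "'a::topological_space \<Rightarrow> 'v::frechet_space"
  assumes "continuous_on S f" "continuous_on S g"
  shows "continuous_on S (\<lambda>s. f s *\<^sub>R g s)"
  using assms unfolding continuous_on_def by (blast intro: tendsto_scaleR_frechet)

lemma small_multiple_in_open:
  fixes a :: "'v::frechet_space"
  assumes "open V" "0 \<in> V"
  obtains l where "0 < l" "l < 1" "l *\<^sub>R a \<in> V"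
proof -
  have "((\<lambda>l. l *\<^sub>R a) \<longlongrightarrow> 0 *\<^sub>R a) (at_right (0::real))"
    by (intro tendsto_scaleR_frechet tendsto_const tendsto_ident_at)
  then have "\<forall>\<^sub>F l in at_right 0. l *\<^sub>R a \<in> V"
    using assms by (auto dest: topological_tendstoD)
  then obtain b :: real where b: "b > 0" "\<And>l. 0 < l \<Longrightarrow> l < b \<Longrightarrow> l *\<^sub>R a \<in> V"
    unfolding eventually_at_right_field by blast
  show thesis
    by (rule that[of "min b 1 / 2"]) (use b in \<open>auto simp: min_def\<close>)
qed

lemma convex_closure_frechet:
  fixes C :: "'v::frechet_space set"
  assumes "convex C"
  shows "convex (closure C)"
proof (rule convexI)
  fix x y :: 'v and u v :: real
  assume xy: "x \<in> closure C" "y \<in> closure C" and uv: "0 \<le> u" "0 \<le> v" "u + v = 1"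
  let ?f = "\<lambda>p. u *\<^sub>R fst p + v *\<^sub>R snd p"
  have "?f ` closure (C \<times> C) \<subseteq> closure C"
  proof (rule image_closure_subset)
    show "continuous_on (closure (C \<times> C)) ?f"
      by (intro continuous_intros continuous_on_scaleR_frechet)
    show "?f ` (C \<times> C) \<subseteq> closure C"
    proof clarify
      fix a b assume "a \<in> C" "b \<in> C"
      then have "u *\<^sub>R a + v *\<^sub>R b \<in> C"
        using assms uv by (auto intro: convexD)
      then show "u *\<^sub>R fst (a, b) + v *\<^sub>R snd (a, b) \<in> closure C"
        by (auto intro: subsetD[OF closure_subset])
    qed
  qed simp
  moreover have "(x, y) \<in> closure (C \<times> C)"
    using xy by (simp add: closure_Times)
  ultimately have "?f (x, y) \<in> closure C"
    by blast
  then show "u *\<^sub>R x + v *\<^sub>R y \<in> closure C"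
    by simp
qed

text \<open>Packages the class axiom so that the abstract metric-space results (Baire, completeness) can be
combined with the topology of the type.\<close>
lemma frechet_metric:
  obtains d :: "'v::frechet_space \<Rightarrow> 'v \<Rightarrow> real"
  where "Metric_space UNIV d" "\<And>x y z. d (x + z) (y + z) = d x y"
    "Metric_space.mtopology UNIV d = euclidean" "Metric_space.mcomplete UNIV d"
proof -
  obtain d :: "'v \<Rightarrow> 'v \<Rightarrow> real" where d: "Metric_space UNIV d" "\<forall>x y z. d (x + z) (y + z) = d x y"
    "\<forall>U. openin (Metric_space.mtopology UNIV d) U \<longleftrightarrow> open U"
    "Metric_space.mcomplete UNIV d"
    using complete_invariant_metric by blast
  have "Metric_space.mtopology UNIV d = euclidean"
    using d(3) by (simp add: topology_eq)
  with d that show thesis by blast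
qed

lemma open_metric_ball:
  fixes d :: "'v::{topological_space, zero} \<Rightarrow> 'v \<Rightarrow> real" and e :: real
  assumes "Metric_space UNIV d" "Metric_space.mtopology UNIV d = euclidean"
  shows "open {x. d 0 x < e}"
proof -
  interpret Metric_space UNIV d by fact
  have "{x. d 0 x < e} = mball 0 e"
    by (auto simp: mball_def)
  then show ?thesis
    using openin_mball[of 0 e] assms(2) by simp
qed

section \<open>Absorbing convex sets and the Baire theorem\<close>

text \<open>The dilates \<open>(n + 1) C\<close> are closed and cover the space, because \<open>C\<close> is absorbing and star-shaped
about \<open>0\<close>. By Baire one of them has interior points, and hence so has \<open>C\<close>.\<close>
lemma closed_absorbing_interior:
  fixes C :: "'v::frechet_space set"
  assumes "closed C" "convex C" "0 \<in> C" and abs: "cone_of C = UNIV"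
  shows "interior C \<noteq> {}"
proof
  assume empty: "interior C = {}"
  obtain d :: "'v \<Rightarrow> 'v \<Rightarrow> real" where d: "Metric_space UNIV d"
    "Metric_space.mtopology UNIV d = euclidean" "Metric_space.mcomplete UNIV d"
    using frechet_metric by metis
  interpret Metric_space UNIV d by fact
  define T where "T n = {y. (1 / real (Suc n)) *\<^sub>R y \<in> C}" for n
  have cont: "continuous_on UNIV (\<lambda>y::'v. c *\<^sub>R y)" for c :: real
    by (intro continuous_on_scaleR_frechet continuous_intros)
  have closed: "closed (T n)" for n
    using closed_vimage[OF assms(1) cont] by (simp add: T_def vimage_def)
  have int: "interior (T n) = {}" for n
  proof (rule ccontr)
    assume "interior (T n) \<noteq> {}"
    then obtain y where y: "y \<in> interior (T n)" by blast
    let ?S = "(\<lambda>z. real (Suc n) *\<^sub>R z) -` interior (T n)"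
    have "open ?S"
      by (rule open_vimage[OF _ cont]) simp
    moreover have "?S \<subseteq> C"
      using interior_subset[of "T n"] by (auto simp: T_def)
    moreover have "(1 / real (Suc n)) *\<^sub>R y \<in> ?S"
      using y by simp
    ultimately show False
      using empty interior_maximal by blast
  qed
  have "mtopology interior_of \<Union>(range T) = {}"
    by (rule metric_Baire_category_alt) (use d closed int in auto)
  moreover have "\<Union>(range T) = UNIV"
  proof -
    have "y \<in> \<Union>(range T)" for y
    proof -
      obtain t c where tc: "t \<ge> 0" "c \<in> C" "y = t *\<^sub>R c"
        using abs cone_of_iff by blast
      obtain n where n: "t \<le> real n" using real_arch_simple by blast
      let ?s = "t / real (Suc n)"
      have "?s *\<^sub>R c + (1 - ?s) *\<^sub>R 0 \<in> C"
        using \<open>convex C\<close> \<open>0 \<in> C\<close> tc n by (intro convexD) auto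
      then have "y \<in> T n" using tc by (simp add: T_def)
      then show ?thesis by blast
    qed
    then show ?thesis by blast
  qed
  ultimately show False
    using d(2) by simp
qed

text \<open>If \<open>u\<close> is interior to \<open>C\<close> and \<open>- u = t c\<close> with \<open>c \<in> C\<close>, then \<open>0\<close> lies on the segment from \<open>u\<close> to \<open>c\<close>,
and an interior endpoint makes every point of the segment other than \<open>c\<close> interior.\<close>
lemma closed_absorbing_nhd:
  fixes C :: "'v::frechet_space set"
  assumes "closed C" "convex C" "0 \<in> C" and abs: "cone_of C = UNIV"
  shows "0 \<in> interior C"
proof -
  obtain u where u: "u \<in> interior C"
    using closed_absorbing_interior[OF assms] by blast
  obtain t c where tc: "t \<ge> 0" "c \<in> C" "- u = t *\<^sub>R c"
    using abs cone_of_iff by blast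
  \<comment> \<open>A point \<open>y\<close> is the combination of \<open>(1 + t) y - t c\<close> and \<open>c\<close> with weights \<open>1 / (1 + t)\<close> and \<open>t / (1 + t)\<close>.\<close>
  let ?W = "(\<lambda>y. (1 + t) *\<^sub>R y - t *\<^sub>R c) -` interior C"
  have "open ?W"
    by (rule open_vimage) (intro open_interior continuous_on_scaleR_frechet continuous_intros)+
  moreover have "?W \<subseteq> C"
  proof
    fix y assume "y \<in> ?W"
    then have "(1 + t) *\<^sub>R y - t *\<^sub>R c \<in> C"
      using interior_subset by auto
    then have "(1 / (1 + t)) *\<^sub>R ((1 + t) *\<^sub>R y - t *\<^sub>R c) + (t / (1 + t)) *\<^sub>R c \<in> C"
      using \<open>convex C\<close> tc by (intro convexD) (auto simp: field_simps)
    then show "y \<in> C"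
      using tc(1) by (simp add: scaleR_diff_right)
  qed
  moreover have "0 \<in> ?W"
    using u tc(3) by (simp flip: tc(3))
  ultimately show ?thesis
    using interior_maximal by blast
qed

text \<open>Shrinking a point \<open>(a, b)\<close> of \<open>G\<close> towards \<open>(0, 0)\<close> brings \<open>a\<close> into \<open>V\<close> and only rescales \<open>b\<close>; therefore the
restriction to \<open>V\<close> leaves the image absorbing.\<close>
lemma closure_local_image_nhd:
  fixes G :: "('x::frechet_space \<times> 'y::frechet_space) set"
  assumes "convex G" "(0, 0) \<in> G" and abs: "cone_of (snd ` G) = UNIV"
    and V: "open V" "convex V" "0 \<in> V"
  shows "0 \<in> interior (closure (snd ` (G \<inter> V \<times> UNIV)))"
proof (rule closed_absorbing_nhd)
  let ?A = "snd ` (G \<inter> V \<times> UNIV)"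
  have "linear (snd :: 'x \<times> 'y \<Rightarrow> 'y)" by (rule linear_snd)
  then have "convex ?A"
    by (rule convex_linear_image) (intro convex_Int convex_Times assms convex_UNIV)
  then show "convex (closure ?A)" by (rule convex_closure_frechet)
  have "0 \<in> ?A"
    using assms(2) V(3) by force
  then show "0 \<in> closure ?A"
    by (rule subsetD[OF closure_subset])
  have "y \<in> cone_of ?A" for y
  proof -
    have "y \<in> cone_of (snd ` G)" using abs by simp
    then obtain t c where "t \<ge> 0" "c \<in> snd ` G" "y = t *\<^sub>R c"
      unfolding cone_of_iff by blast
    then obtain a b where tab: "t \<ge> 0" "(a, b) \<in> G" "y = t *\<^sub>R b"
      by force
    obtain l where l: "0 < l" "l < 1" "l *\<^sub>R a \<in> V"
      using small_multiple_in_open[OF V(1,3)] by blast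
    have "l *\<^sub>R (a, b) + (1 - l) *\<^sub>R (0, 0) \<in> G"
      using assms tab l by (intro convexD) auto
    then have "l *\<^sub>R b \<in> ?A"
      using l by force
    moreover have "y = (t / l) *\<^sub>R (l *\<^sub>R b)" "t / l \<ge> 0"
      using tab l by auto
    ultimately show ?thesis
      unfolding cone_of_iff by blast
  qed
  then show "cone_of (closure ?A) = UNIV"
    using cone_of_mono[OF closure_subset[of ?A]] by blast
qed simp

section \<open>An open mapping theorem for closed convex relations\<close>

text \<open>The weights sum to less than \<open>1\<close>, and \<open>0\<close> takes the missing mass.\<close>
lemma dyadic_sum_in_convex:
  fixes p :: "nat \<Rightarrow> 'v::real_vector"
  assumes "convex G" "0 \<in> G" "\<And>k. p k \<in> G"
  shows "(\<Sum>k<n. (1 / 2 ^ Suc k) *\<^sub>R p k) \<in> G"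
  using assms(3)
proof (induction n arbitrary: p)
  case 0
  then show ?case using assms by simp
next
  case (Suc n)
  have "(1/2) *\<^sub>R p 0 + (1/2) *\<^sub>R (\<Sum>k<n. (1 / 2 ^ Suc k) *\<^sub>R p (Suc k)) \<in> G"
    using Suc assms(1) by (intro convexD) auto
  then show ?case
    by (subst sum.lessThan_Suc_shift) (simp add: scaleR_sum_right)
qed

lemma convergent_if_dyadic_increments:
  assumes "Metric_space UNIV d" "Metric_space.mcomplete UNIV d"
    and step: "\<And>n. d (s n) (s (Suc n)) \<le> 1 / 2 ^ n"
  shows "\<exists>x. limitin (Metric_space.mtopology UNIV d) s x sequentially"
proof -
  interpret Metric_space UNIV d by fact
  have bound: "d (s m) (s (m + k)) \<le> 2 / 2 ^ m - 2 / 2 ^ (m + k)" for m k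
  proof (induction k)
    case (Suc k)
    have "d (s m) (s (m + Suc k)) \<le> d (s m) (s (m + k)) + d (s (m + k)) (s (Suc (m + k)))"
      using triangle[of "s m" "s (m + k)" "s (Suc (m + k))"] by simp
    moreover have "1 / 2 ^ (m + k) = 2 / 2 ^ (m + k) - (2::real) / 2 ^ (m + Suc k)"
      by simp
    ultimately show ?case using Suc step[of "m + k"] by linarith
  qed simp
  have "MCauchy s"
    unfolding MCauchy_def
  proof (intro conjI allI impI)
    fix e :: real assume "e > 0"
    then obtain N where N: "(1/2) ^ N < e / 2"
      using real_arch_pow_inv[of "e/2" "1/2"] by auto
    have *: "d (s m) (s (m + k)) < e" if "N \<le> m" for m k
    proof -
      have "(1/2::real) ^ m \<le> (1/2) ^ N" using that by (intro power_decreasing) auto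
      moreover have "2 / 2 ^ m = 2 * (1/2::real) ^ m" by (simp add: power_one_over)
      moreover have "(0::real) \<le> 2 / 2 ^ (m + k)" by simp
      ultimately show ?thesis using bound[of m k] N by linarith
    qed
    have "d (s n) (s n') < e" if "N \<le> n" "N \<le> n'" for n n'
      by (cases n n' rule: le_cases) (metis * that le_add_diff_inverse commute)+
    then show "\<exists>N. \<forall>n n'. N \<le> n \<longrightarrow> N \<le> n' \<longrightarrow> d (s n) (s n') < e"
      by blast
  qed simp
  then show ?thesis
    using assms(2) unfolding mcomplete_def by blast
qed

text \<open>Successive approximation. The set \<open>U n\<close> consists of small points \<open>w\<close> such that \<open>2 w\<close> can be approximated by
some \<open>b\<close> with \<open>(a, b) \<in> G\<close> and \<open>a\<close> in the \<open>2^-n\<close>-ball, as closely as wanted; in particular so closely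
that the new remainder \<open>2 w - b\<close> falls into \<open>U (n + 1)\<close>. Doubling the remainder at each step is what gives
the \<open>n\<close>-th correction the weight \<open>2^-(n+1)\<close>.\<close>
lemma closed_convex_image_nhd_origin:
  fixes G :: "('x::frechet_space \<times> 'y::frechet_space) set"
  assumes "closed G" "convex G" "(0, 0) \<in> G" and abs: "cone_of (snd ` G) = UNIV"
  shows "0 \<in> interior (snd ` G)"
proof -
  obtain d :: "'x \<Rightarrow> 'x \<Rightarrow> real" where d: "Metric_space UNIV d"
    "\<And>x y z. d (x + z) (y + z) = d x y"
    "Metric_space.mtopology UNIV d = euclidean" "Metric_space.mcomplete UNIV d"
    using frechet_metric by blast
  obtain d' :: "'y \<Rightarrow> 'y \<Rightarrow> real" where d': "Metric_space UNIV d'"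
    "Metric_space.mtopology UNIV d' = euclidean"
    using frechet_metric by metis
  interpret X: Metric_space UNIV d by fact
  interpret Y: Metric_space UNIV d' by fact
  have "\<exists>C. open C \<and> convex C \<and> 0 \<in> C \<and> C \<subseteq> {x. d 0 x < 1 / 2 ^ n}" for n :: nat
    using locally_convex[OF open_metric_ball[OF d(1,3)], of "1 / 2 ^ n"]
    unfolding convex_def by (simp, metis)
  then obtain V where V: "\<And>n::nat. open (V n)" "\<And>n. convex (V n)" "\<And>n. 0 \<in> V n"
    "\<And>n. V n \<subseteq> {x. d 0 x < 1 / 2 ^ n}"
    by metis
  define A where "A n = snd ` (G \<inter> V n \<times> UNIV)" for n
  define U where "U n = (\<lambda>w. 2 *\<^sub>R w) -` interior (closure (A n)) \<inter> {w. d' 0 w < 1 / 2 ^ n}" for n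
  have U_open: "open (U n)" for n
    unfolding U_def
    by (intro open_Int open_vimage open_metric_ball d' open_interior
        continuous_on_scaleR_frechet continuous_intros)
  have U_0: "0 \<in> U n" for n
    using closure_local_image_nhd[OF assms(2,3) abs V(1-3)] by (simp add: U_def A_def)
  have "U 0 \<subseteq> snd ` G"
  proof
    fix y assume y: "y \<in> U 0"
    have step: "\<exists>a b. (a, b) \<in> G \<and> a \<in> V n \<and> 2 *\<^sub>R w - b \<in> U (Suc n)" if "w \<in> U n" for n w
    proof -
      have "open ((\<lambda>b. 2 *\<^sub>R w - b) -` U (Suc n))"
        by (intro open_vimage U_open continuous_intros)
      moreover have "2 *\<^sub>R w \<in> closure (A n)"
        using that interior_subset by (auto simp: U_def)
      moreover have "2 *\<^sub>R w \<in> (\<lambda>b. 2 *\<^sub>R w - b) -` U (Suc n)"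
        using U_0 by simp
      ultimately have "A n \<inter> (\<lambda>b. 2 *\<^sub>R w - b) -` U (Suc n) \<noteq> {}"
        by (metis IntI Int_commute empty_iff open_Int_closure_eq_empty)
      then show ?thesis by (force simp: A_def)
    qed
    obtain w where w: "w 0 = y" "\<And>n. w n \<in> U n"
      "\<And>n. \<exists>a b. (a, b) \<in> G \<and> a \<in> V n \<and> w (Suc n) = 2 *\<^sub>R w n - b"
      using dependent_nat_choice[of "\<lambda>n u. u \<in> U n \<and> (n = 0 \<longrightarrow> u = y)"
          "\<lambda>n u u'. \<exists>a b. (a, b) \<in> G \<and> a \<in> V n \<and> u' = 2 *\<^sub>R u - b"] y step
      by (metis nat.distinct(1))
    obtain a b where ab: "\<And>n. (a n, b n) \<in> G" "\<And>n. a n \<in> V n"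
      "\<And>n. w (Suc n) = 2 *\<^sub>R w n - b n"
      using w(3) by metis
    define s where "s n = (\<Sum>k<n. (1 / 2 ^ Suc k) *\<^sub>R a k)" for n
    define t where "t n = (\<Sum>k<n. (1 / 2 ^ Suc k) *\<^sub>R b k)" for n
    have st: "(s n, t n) \<in> G" for n
    proof -
      have "(\<Sum>k<n. (1 / 2 ^ Suc k) *\<^sub>R (a k, b k)) \<in> G"
        using assms ab by (intro dyadic_sum_in_convex) (auto simp: zero_prod_def)
      then show ?thesis by (simp add: s_def t_def sum_prod)
    qed
    have "d (s n) (s (Suc n)) \<le> 1 / 2 ^ n" for n
    proof -
      have "(1 / 2 ^ Suc n) *\<^sub>R a n + (1 - 1 / 2 ^ Suc n) *\<^sub>R 0 \<in> V n"
        using V ab by (intro convexD) (auto simp: field_simps simp flip: power_Suc)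
      then have "d 0 ((1 / 2 ^ Suc n) *\<^sub>R a n) < 1 / 2 ^ n"
        using V(4)[of n] by auto
      then show ?thesis
        using d(2)[of 0 "s n" "(1 / 2 ^ Suc n) *\<^sub>R a n"] by (simp add: s_def add.commute)
    qed
    then obtain x where "limitin euclidean s x sequentially"
      using convergent_if_dyadic_increments[OF d(1,4)] d(3) by metis
    then have s_lim: "s \<longlonglongrightarrow> x" by simp
    \<comment> \<open>The remainder \<open>w n\<close> measures the error of the \<open>n\<close>-th partial sum on the scale \<open>2^-n\<close>.\<close>
    have w_eq: "t n = y - (1 / 2 ^ n) *\<^sub>R w n" for n
    proof (induction n)
      case (Suc n)
      then show ?case
        by (simp add: t_def ab(3) algebra_simps)
    qed (simp add: t_def w)
    have "limitin euclidean w 0 sequentially"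
      unfolding d'(2)[symmetric] Y.limitin_metric
    proof (intro conjI allI impI)
      fix e :: real assume "e > 0"
      then have "\<forall>\<^sub>F n in sequentially. (1/2::real) ^ n < e"
        by (intro order_tendstoD(2)[OF LIMSEQ_power_zero]) auto
      then show "\<forall>\<^sub>F n in sequentially. w n \<in> UNIV \<and> d' (w n) 0 < e"
      proof eventually_elim
        case (elim n)
        then show ?case
          using w(2)[of n] by (simp add: U_def power_one_over Y.commute)
      qed
    qed simp
    then have "w \<longlonglongrightarrow> 0" by simp
    moreover have "(\<lambda>n. 1 / 2 ^ n :: real) \<longlonglongrightarrow> 0"
      using LIMSEQ_power_zero[of "1/2::real"] by (simp add: power_one_over)
    ultimately have "(\<lambda>n. y - (1 / 2 ^ n) *\<^sub>R w n) \<longlonglongrightarrow> y - 0 *\<^sub>R 0"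
      by (intro tendsto_diff tendsto_const tendsto_scaleR_frechet)
    then have "t \<longlonglongrightarrow> y"
      by (simp add: w_eq[abs_def])
    then have "(x, y) \<in> G"
      using st by (intro Lim_in_closed_set[OF assms(1) _ _ tendsto_Pair[OF s_lim]]) auto
    then show "y \<in> snd ` G" by force
  qed
  then show ?thesis
    using U_open U_0 interior_maximal by blast
qed

text \<open>A translation in \<open>X\<close> moves a point of \<open>G\<close> above \<open>0\<close> to the origin and leaves the projection unchanged.\<close>
lemma closed_convex_image_nhd:
  fixes G :: "('x::frechet_space \<times> 'y::frechet_space) set"
  assumes "closed G" "convex G" and core: "0 \<in> core (snd ` G)"
  shows "0 \<in> interior (snd ` G)"
proof -
  obtain x0 where x0: "(x0, 0) \<in> G"
    using core by (auto simp: core_def)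
  let ?G = "(\<lambda>p. p + (x0, 0)) -` G"
  have "p \<in> (\<lambda>q. q - (x0, 0)) ` G" if "p + (x0, 0) \<in> G" for p
    using that by force
  then have G_eq: "?G = (\<lambda>q. q - (x0, 0)) ` G" by auto
  then have snd_eq: "snd ` ?G = snd ` G"
    by (simp add: image_image)
  have "(\<lambda>p::'x \<times> 'y. p + (x0, 0)) = (\<lambda>p. (fst p + x0, snd p))"
    by auto
  then have "continuous_on UNIV (\<lambda>p::'x \<times> 'y. p + (x0, 0))"
    by (simp only:) (intro continuous_intros)
  then have "closed ?G"
    using assms(1) closed_vimage by blast
  moreover have "convex ?G"
    unfolding G_eq using assms(2) by (rule convex_translation_subtract)
  moreover have "(0, 0) \<in> ?G" using x0 by simp
  moreover have "cone_of (snd ` ?G) = UNIV"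
    unfolding snd_eq using core by (simp add: core_def)
  ultimately show ?thesis
    using closed_convex_image_nhd_origin[of ?G] snd_eq by simp
qed

section \<open>Sublevel sets and the value function\<close>

lemma closed_sublevel:
  assumes "lsc_fun f"
  shows "closed {z. f z \<le> c}"
proof -
  have "open {z. c < f z}"
  proof (subst open_subopen, rule ballI)
    fix z assume "z \<in> {z. c < f z}"
    then have "c < Liminf (nhds z) f"
      using assms unfolding lsc_fun_def by (auto intro: less_le_trans)
    then have "\<forall>\<^sub>F u in nhds z. c < f u"
      by (rule less_LiminfD)
    then show "\<exists>T. open T \<and> z \<in> T \<and> T \<subseteq> {z. c < f z}"
      unfolding eventually_nhds by blast
  qed
  moreover have "- {z. f z \<le> c} = {z. c < f z}" by auto
  ultimately show ?thesis by (simp add: closed_def)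
qed

lemma convex_fun_bound:
  assumes "convex_fun f" "f z \<le> ereal a" "f w \<le> ereal b" "0 < t" "t < 1"
  shows "f (t *\<^sub>R z + (1 - t) *\<^sub>R w) \<le> ereal (t * a + (1 - t) * b)"
proof -
  have "f (t *\<^sub>R z + (1 - t) *\<^sub>R w) \<le> ereal t * f z + ereal (1 - t) * f w"
    using assms unfolding convex_fun_def by auto
  also have "\<dots> \<le> ereal t * ereal a + ereal (1 - t) * ereal b"
    using assms by (intro add_mono ereal_mult_left_mono) auto
  finally show ?thesis by simp
qed

lemma convex_sublevel:
  assumes "convex_fun f"
  shows "convex {z. f z \<le> ereal c}"
proof (rule convexI)
  fix z w and u v :: real
  assume zw: "z \<in> {z. f z \<le> ereal c}" "w \<in> {z. f z \<le> ereal c}" and uv: "0 \<le> u" "0 \<le> v" "u + v = 1"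
  have v: "v = 1 - u" using uv by simp
  consider "u = 0" | "u = 1" | "0 < u" "u < 1"
    using uv by linarith
  then show "u *\<^sub>R z + v *\<^sub>R w \<in> {z. f z \<le> ereal c}"
  proof cases
    case 3
    then show ?thesis
      using convex_fun_bound[OF assms, of z c w c u] zw by (simp add: v algebra_simps)
  qed (use zw v in auto)
qed

lemma below_infinity_bound:
  assumes "(x::ereal) < \<infinity>"
  obtains r where "x \<le> ereal r"
  using assms by (cases x) auto

text \<open>The open mapping theorem is applied to a sublevel set and not to the domain of \<open>\<Phi>\<close>, which need not be
closed. The choice also yields a uniform bound, used again for the cone generated by \<open>E\<close>.\<close>
lemma bounded_above_near_core:
  fixes \<Phi> :: "'x::frechet_space \<times> 'y::frechet_space \<Rightarrow> ereal"
  assumes conv: "convex_fun \<Phi>" and "lsc_fun \<Phi>" and core: "0 \<in> core (prY_dom \<Phi>)"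
  obtains M where "0 \<in> interior {y. \<exists>x. \<Phi> (x, y) \<le> ereal M}"
proof -
  obtain x0 where "\<Phi> (x0, 0) < \<infinity>"
    using core by (auto simp: core_def prY_dom_def effective_domain_def)
  then obtain r where r: "\<Phi> (x0, 0) \<le> ereal r" by (rule below_infinity_bound)
  let ?G = "{z. \<Phi> z \<le> ereal (r + 1)}"
  have "y \<in> cone_of (snd ` ?G)" for y
  proof -
    have "y \<in> cone_of (prY_dom \<Phi>)"
      using core by (simp add: core_def)
    then obtain t a b where tab: "t \<ge> 0" "\<Phi> (a, b) < \<infinity>" "y = t *\<^sub>R b"
      by (auto simp: cone_of_iff prY_dom_def effective_domain_def)
    obtain m where m: "\<Phi> (a, b) \<le> ereal m" using tab(2) by (rule below_infinity_bound)
    \<comment> \<open>Small enough that \<open>l (m - r) \<le> 1\<close>, with \<open>2\<close> instead of \<open>1\<close> to have \<open>l < 1\<close>.\<close>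
    define l where "l = 1 / (2 + \<bar>m - r\<bar>)"
    have l: "0 < l" "l < 1" "l * (m - r) \<le> 1"
      by (auto simp: l_def field_simps abs_if)
    have "l * m + (1 - l) * r \<le> r + 1"
      using l(3) by (simp add: algebra_simps)
    then have "l *\<^sub>R (a, b) + (1 - l) *\<^sub>R (x0, 0) \<in> ?G"
      using convex_fun_bound[OF conv m r l(1,2)] by (auto intro: order_trans)
    then have "l *\<^sub>R b \<in> snd ` ?G" by force
    moreover have "y = (t / l) *\<^sub>R (l *\<^sub>R b)" "t / l \<ge> 0"
      using tab l by auto
    ultimately show ?thesis
      unfolding cone_of_iff by blast
  qed
  moreover have "(x0, 0) \<in> ?G"
    using r by (auto intro: order_trans)
  then have "0 \<in> snd ` ?G" by force
  ultimately have "0 \<in> core (snd ` ?G)"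
    by (auto simp: core_def)
  then have "0 \<in> interior (snd ` ?G)"
    by (rule closed_convex_image_nhd[OF closed_sublevel[OF assms(2)] convex_sublevel[OF conv]])
  moreover have "snd ` ?G = {y. \<exists>x. \<Phi> (x, y) \<le> ereal (r + 1)}" by force
  ultimately show thesis using that by simp
qed

lemma zero_in_core_if_interior:
  fixes D :: "'v::frechet_space set"
  assumes "0 \<in> interior D"
  shows "0 \<in> core D"
proof -
  have "y \<in> cone_of D" for y
  proof -
    obtain l where l: "0 < l" "l *\<^sub>R y \<in> interior D"
      using small_multiple_in_open[OF open_interior assms] by blast
    then have "y = (1 / l) *\<^sub>R (l *\<^sub>R y)" "l *\<^sub>R y \<in> D" "1 / l \<ge> 0"
      using interior_subset by auto
    then show ?thesis unfolding cone_of_iff by blast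
  qed
  then show ?thesis
    using assms interior_subset by (auto simp: core_def)
qed

section \<open>Quasi-interiors and the cone generated by E\<close>

text \<open>If the closed cone generated by \<open>D\<close> is a subspace, it contains all differences of points of \<open>D\<close>, hence
also the closed cone generated by them; conversely \<open>D \<subseteq> D - D\<close> as soon as \<open>0 \<in> D\<close>.\<close>
lemma qi_zero_iff:
  fixes D :: "'v::{real_vector, topological_space} set"
  shows "0 \<in> qi D \<longleftrightarrow> 0 \<in> qi {a - b | a b. a \<in> D \<and> b \<in> D} \<and> 0 \<in> qri D"
    (is "_ \<longleftrightarrow> 0 \<in> qi ?D \<and> _")
proof
  assume L: "0 \<in> qi D"
  have D0: "0 \<in> D" using L by (simp add: qi_def)
  have D: "D \<subseteq> ?D"
  proof
    fix a assume "a \<in> D"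
    then have "a - 0 \<in> ?D" using D0 by blast
    then show "a \<in> ?D" by (simp only: diff_zero)
  qed
  have "closure (cone_of D) = UNIV"
    using L by (simp add: qi_def)
  moreover have "closure (cone_of D) \<subseteq> closure (cone_of ?D)"
    by (intro closure_mono cone_of_mono D)
  ultimately have "closure (cone_of D) = UNIV" "closure (cone_of ?D) = UNIV"
    by (simp_all only: top.extremum_unique)
  moreover have "0 \<in> ?D" by (rule subsetD[OF D D0])
  ultimately show "0 \<in> qi ?D \<and> 0 \<in> qri D"
    using D0 by (simp only: qi_def qri_def diff_zero image_ident mem_Collect_eq subspace_UNIV simp_thms)
next
  assume R: "0 \<in> qi ?D \<and> 0 \<in> qri D"
  let ?L = "closure (cone_of D)"
  have sub: "subspace ?L" and D: "0 \<in> D"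
    using conjunct2[OF R] by (simp_all add: qri_def)
  have "D \<subseteq> ?L"
  proof
    fix y assume "y \<in> D"
    then have "y \<in> cone_of D"
      unfolding cone_of_iff by (intro exI[of _ 1]) auto
    then show "y \<in> ?L" using closure_subset by blast
  qed
  have DD: "?D \<subseteq> ?L"
  proof clarify
    fix a b assume "a \<in> D" "b \<in> D"
    then show "a - b \<in> ?L"
      using subsetD[OF \<open>D \<subseteq> ?L\<close>] by (intro subspace_diff[OF sub])
  qed
  have "cone_of ?D \<subseteq> ?L"
  proof
    fix y assume "y \<in> cone_of ?D"
    then obtain t c where "c \<in> ?D" "y = t *\<^sub>R c"
      unfolding cone_of_iff by blast
    then show "y \<in> ?L"
      using subspace_scale[OF sub subsetD[OF DD]] by simp
  qed
  then have "closure (cone_of ?D) \<subseteq> ?L"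
    by (rule closure_minimal) simp
  moreover have "closure (cone_of ?D) = UNIV"
    using conjunct1[OF R] by (simp only: qi_def diff_zero image_ident mem_Collect_eq)
  ultimately have "?L = UNIV"
    by (simp only: top.extremum_unique)
  then show "0 \<in> qi D"
    using D by (simp add: qi_def)
qed

lemma E_set_iff:
  assumes "primal_value \<Phi> = ereal v"
  shows "(y, r) \<in> E_set \<Phi> \<longleftrightarrow> (\<exists>x. \<Phi> (x, y) \<le> ereal (r + v))"
proof -
  have "c - ereal v \<le> ereal r \<longleftrightarrow> c \<le> ereal (r + v)" for c
    by (cases c) auto
  then show ?thesis
    by (force simp: E_set_def epi_def assms)
qed

text \<open>The closed cone contains \<open>(0, 1)\<close>. To see that it misses \<open>(0, -1)\<close>, suppose that \<open>(c y, c r)\<close> with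
\<open>(y, r) \<in> E\<close> and \<open>c > 0\<close> is close to it. Then \<open>u = - k y\<close> with \<open>k = 2 K c\<close> is close to \<open>0\<close>, so \<open>(u, K) \<in> E\<close> for
the uniform bound \<open>K\<close>. The point of the segment from \<open>(y, r)\<close> to \<open>(u, K)\<close> over \<open>0\<close> has nonnegative height
because the primal value is the infimum over the fibre at \<open>0\<close>; this means \<open>k r + K \<ge> 0\<close>, whereas
\<open>c r < - 1/2\<close> gives \<open>k r < - K\<close>.\<close>
lemma origin_not_in_qri_hull_E_set:
  fixes \<Phi> :: "'x::frechet_space \<times> 'y::frechet_space \<Rightarrow> ereal"
  assumes conv: "convex_fun \<Phi>" and v: "primal_value \<Phi> = ereal v"
    and bdd: "0 \<in> interior {y. \<exists>x. \<Phi> (x, y) \<le> ereal M}"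
  shows "(0, 0) \<notin> qri (convex hull (E_set \<Phi> \<union> {(0, 0)}))"
proof
  let ?E = "E_set \<Phi>" and ?H = "convex hull (E_set \<Phi> \<union> {(0, 0)})"
  assume "(0, 0) \<in> qri ?H"
  then have sub: "subspace (closure (cone_of ?H))"
    by (simp add: qri_def flip: zero_prod_def)
  have E_comb: "(t *\<^sub>R y + (1 - t) *\<^sub>R y', t * r + (1 - t) * r') \<in> ?E"
    if E: "(y, r) \<in> ?E" "(y', r') \<in> ?E" and t: "0 < t" "t < 1" for t y y' r r'
  proof -
    obtain x x' where "\<Phi> (x, y) \<le> ereal (r + v)" "\<Phi> (x', y') \<le> ereal (r' + v)"
      using E unfolding E_set_iff[OF v] by blast
    from convex_fun_bound[OF conv this t]
    show ?thesis
      unfolding E_set_iff[OF v] by (auto simp: algebra_simps)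
  qed
  have E_conv: "convex ?E"
  proof (rule convexI)
    fix p q and t s :: real
    assume *: "p \<in> ?E" "q \<in> ?E" "0 \<le> t" "0 \<le> s" "t + s = 1"
    then have s: "s = 1 - t" by simp
    consider "t = 0" | "t = 1" | "0 < t" "t < 1"
      using * by linarith
    then show "t *\<^sub>R p + s *\<^sub>R q \<in> ?E"
      unfolding s
      by cases (use * E_comb[of "fst p" "snd p" "fst q" "snd q" t] in \<open>auto simp: scaleR_prod_def plus_prod_def\<close>)
  qed
  have E_0: "r \<ge> 0" if "(0, r) \<in> ?E" for r
  proof -
    obtain x where "\<Phi> (x, 0) \<le> ereal (r + v)"
      using \<open>(0, r) \<in> ?E\<close> E_set_iff[OF v] by blast
    then have "ereal v \<le> ereal (r + v)"
      unfolding v[symmetric] primal_value_def by (auto intro: INF_lower2)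
    then show ?thesis by simp
  qed
  have E_1: "(0, 1) \<in> ?E"
  proof -
    have "(INF x. \<Phi> (x, 0)) < ereal (1 + v)"
      using v by (simp add: primal_value_def)
    then obtain x where "\<Phi> (x, 0) < ereal (1 + v)"
      by (auto simp: INF_less_iff)
    then show ?thesis
      unfolding E_set_iff[OF v] by (blast intro: less_imp_le)
  qed
  have "(0, 1) \<in> ?H"
    using E_1 by (simp add: hull_inc)
  then have "(0, 1) \<in> cone_of ?H"
    unfolding cone_of_iff by (intro exI[of _ 1]) auto
  then have "(0, 1) \<in> closure (cone_of ?H)"
    using closure_subset by blast
  then have "- (0, 1) \<in> closure (cone_of ?H)"
    using sub by (rule subspace_neg[rotated])
  then have mem: "(0, - 1) \<in> closure (cone_of ?H)" by simp

  define B where "B = {y. \<exists>x. \<Phi> (x, y) \<le> ereal M}"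
  \<comment> \<open>Only an upper bound for the shifted value is needed; the absolute value and \<open>+ 1\<close> make it positive.\<close>
  define K where "K = \<bar>M - v\<bar> + 1"
  have K: "K > 0" "M \<le> K + v" by (auto simp: K_def)
  have B_E: "(u, K) \<in> ?E" if u: "u \<in> B" for u
  proof -
    obtain x where "\<Phi> (x, u) \<le> ereal M"
      using u by (auto simp: B_def)
    also have "ereal M \<le> ereal (K + v)" using K(2) by simp
    finally show ?thesis unfolding E_set_iff[OF v] by blast
  qed
  \<comment> \<open>With the factor \<open>2 K\<close>, the height \<open>K\<close> over the opposite point cannot make up for \<open>c r < - 1/2\<close>.\<close>
  define N where "N = (\<lambda>y. (- 2 * K) *\<^sub>R y) -` interior B \<times> {..< - (1/2::real)}"
  have "open N"
    unfolding N_def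
    by (intro open_Times open_lessThan open_vimage open_interior
        continuous_on_scaleR_frechet continuous_intros)
  moreover have "(0, - 1) \<in> N"
    using bdd by (simp add: N_def B_def)
  ultimately have "N \<inter> cone_of ?H \<noteq> {}"
    using mem open_Int_closure_eq_empty by blast
  then obtain p where p: "p \<in> N" "p \<in> cone_of ?H" by blast
  then obtain t q where tq: "t \<ge> 0" "q \<in> ?H" "p = t *\<^sub>R q"
    by (auto simp: cone_of_iff)
  have "?E \<noteq> {}" using E_1 by blast
  then have "?H = {q. \<exists>a\<ge>0. \<exists>b\<ge>0. \<exists>e. a + b = 1 \<and> e \<in> convex hull ?E \<and> q = a *\<^sub>R (0, 0) + b *\<^sub>R e}"
    using convex_hull_insert[of ?E "(0, 0)"] by simp
  then obtain a b e where "e \<in> convex hull ?E" "b \<ge> 0" "q = a *\<^sub>R (0, 0) + b *\<^sub>R e"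
    using tq(2) by blast
  moreover have "convex hull ?E = ?E"
    using E_conv by (rule hull_same)
  ultimately have be: "b \<ge> 0" "e \<in> ?E" "q = b *\<^sub>R e"
    by (auto simp flip: zero_prod_def)
  obtain y r where e: "e = (y, r)" by force
  define c where "c = t * b"
  have p_eq: "p = (c *\<^sub>R y, c * r)" and "c \<ge> 0"
    using tq be e by (auto simp: c_def)
  have cr: "c * r < - (1/2)" and u: "(- 2 * K * c) *\<^sub>R y \<in> B"
    using p(1) interior_subset[of B] by (auto simp: N_def p_eq)
  have "c > 0" using cr \<open>c \<ge> 0\<close> by (cases "c = 0") auto
  define k where "k = 2 * K * c"
  have "k > 0" using K \<open>c > 0\<close> by (simp add: k_def)
  \<comment> \<open>The weight for which \<open>l y + (1 - l) (- k y) = 0\<close>.\<close>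
  define l where "l = k / (1 + k)"
  have l: "0 < l" "l < 1" "1 - l = 1 / (1 + k)"
    using \<open>k > 0\<close> by (auto simp: l_def field_simps)
  have "(- k *\<^sub>R y, K) \<in> ?E"
    using B_E[OF u] by (simp add: k_def)
  from E_comb[OF be(2)[unfolded e] this l(1,2)]
  have "(0, l * r + (1 - l) * K) \<in> ?E"
    unfolding l(3) by (simp add: l_def)
  then have "0 \<le> l * r + (1 - l) * K" by (rule E_0)
  also have "\<dots> = (k * r + K) / (1 + k)"
    unfolding l(3) by (simp add: l_def add_divide_distrib)
  finally have "0 \<le> k * r + K"
    using \<open>k > 0\<close> by (simp add: zero_le_divide_iff)
  moreover have "k * r < - K"
    using mult_strict_left_mono[OF cr, of "2 * K"] K(1) by (simp add: k_def)
  ultimately show False by simp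
qed

theorem proposition12:
  fixes \<Phi> :: "'x::frechet_space \<times> 'y::frechet_space \<Rightarrow> ereal"
  assumes "proper_fun \<Phi>" and "convex_fun \<Phi>" and "lsc_fun \<Phi>"
    and "\<bar>primal_value \<Phi>\<bar> \<noteq> \<infinity>"
  shows "(RC1 \<Phi> \<longrightarrow> RC2 \<Phi>) \<and> (RC2 \<Phi> \<longleftrightarrow> RC3 \<Phi>) \<and> (RC3 \<Phi> \<longrightarrow> RC6 \<Phi>) \<and> (RC6 \<Phi> \<longleftrightarrow> RC7 \<Phi>)"
proof (intro conjI)
  show "RC1 \<Phi> \<longrightarrow> RC2 \<Phi>"
  proof
    assume "RC1 \<Phi>"
    then obtain x' where x': "\<Phi> (x', 0) < \<infinity>" "isCont (\<lambda>y. \<Phi> (x', y)) 0"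
      by (auto simp: RC1_def effective_domain_def)
    have "((\<lambda>y. \<Phi> (x', y)) \<longlongrightarrow> \<Phi> (x', 0)) (nhds 0)"
      using x'(2) tendsto_at_iff_tendsto_nhds[of "\<lambda>y. \<Phi> (x', y)" 0] by (simp add: isCont_def)
    then have "\<forall>\<^sub>F y in nhds 0. \<Phi> (x', y) < \<infinity>"
      using x'(1) by (rule order_tendstoD(2))
    then obtain S where "open S" "0 \<in> S" "\<forall>y\<in>S. \<Phi> (x', y) < \<infinity>"
      unfolding eventually_nhds by blast
    then show "RC2 \<Phi>"
      unfolding RC2_def
      by (intro interiorI[of S]) (force simp: prY_dom_def effective_domain_def)+
  qed
  show "RC2 \<Phi> \<longleftrightarrow> RC3 \<Phi>"
  proof
    show "RC3 \<Phi>" if "RC2 \<Phi>"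
      using that zero_in_core_if_interior by (auto simp: RC2_def RC3_def)
    show "RC2 \<Phi>" if "RC3 \<Phi>"
    proof -
      obtain M where M: "0 \<in> interior {y. \<exists>x. \<Phi> (x, y) \<le> ereal M}"
        using bounded_above_near_core[OF assms(2,3)] \<open>RC3 \<Phi>\<close> unfolding RC3_def by blast
      have "{y. \<exists>x. \<Phi> (x, y) \<le> ereal M} \<subseteq> prY_dom \<Phi>"
      proof
        fix y assume "y \<in> {y. \<exists>x. \<Phi> (x, y) \<le> ereal M}"
        then obtain x where "\<Phi> (x, y) \<le> ereal M" by blast
        then have "\<Phi> (x, y) < \<infinity>" by (auto simp: less_top[symmetric])
        then show "y \<in> prY_dom \<Phi>"
          unfolding prY_dom_def effective_domain_def by force
      qed
      then show ?thesis
        using M interior_mono unfolding RC2_def by blast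
    qed
  qed
  show "RC3 \<Phi> \<longrightarrow> RC6 \<Phi>"
  proof
    assume rc3: "RC3 \<Phi>"
    then obtain M where "0 \<in> interior {y. \<exists>x. \<Phi> (x, y) \<le> ereal M}"
      using bounded_above_near_core[OF assms(2,3)] unfolding RC3_def by blast
    moreover obtain v where "primal_value \<Phi> = ereal v"
      using assms(4) by (cases "primal_value \<Phi>") auto
    ultimately show "RC6 \<Phi>"
      using origin_not_in_qri_hull_E_set[OF assms(2)] rc3
      by (auto simp: RC3_def RC6_def core_def qi_def)
  qed
  show "RC6 \<Phi> \<longleftrightarrow> RC7 \<Phi>"
    unfolding RC6_def RC7_def by (subst qi_zero_iff) blast
qed

end
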